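(* Consider the Gaussian channel described in the context, with channel power gains $g_1^p,g_2^p,g_s^p,g_1^s,g_2^s,g_s^s>0$, powers $P_1,P_2,P_s>0$ and noise variance $N_0>0$. Let $i,j\in\{1,2\}$ with $j\ne i$. Then the inequality $I(Y_p;X_i|W)\le I(Y_s;X_i|UW)$ holds for all $Z\in\mathcal{G}(P_1,P_2,P_s)$, equivalently $$\tfrac12\log_2\!\left(1+\frac{g_i^pP_i}{g_s^p\lambda P_s+g_j^pP_j+N_0}\right)\le\tfrac12\log_2\!\left(1+\frac{g_i^sP_i}{g_j^sP_j+N_0}\right)\quad\text{for all }\lambda\in[0,1],$$ if and only if $$\frac{g_i^p}{g_j^pP_j+N_0}\le\frac{g_i^s}{g_j^sP_j+N_0}.$$ Moreover, if this holds then $\mathcal{R}^o_g\subseteq\mathcal{R}^r_{ig}$.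
   Context: Gaussian channel: real inputs $x_1,x_2,x_s$ and outputs $$y_p=\sqrt{g_1^p}\,x_1+\sqrt{g_2^p}\,x_2+\sqrt{g_s^p}\,x_s+n_p,\qquad y_s=\sqrt{g_1^s}\,x_1+\sqrt{g_2^s}\,x_2+\sqrt{g_s^s}\,x_s+n_s,$$ where $n_p,n_s$ are independent zero-mean Gaussian noises of variance $N_0$, independent of the inputs. $\mathcal{G}(P_1,P_2,P_s)$ is the set of $Z=UWX_1X_2X_sY_pY_s$ (time-sharing variable $Q$ constant, hence omitted) where $X_1,X_2,U,W$ are independent zero-mean Gaussian random variables, $X_s=U+W$, $\mathrm{Var}(X_1)=P_1$, $\mathrm{Var}(X_2)=P_2$, $\mathrm{Var}(X_s)=P_s$, and $Y_p,Y_s$ are the corresponding channel outputs. The elements are parametrized by $\lambda\in[0,1]$ via $\mathrm{Var}(U)=\lambda P_s$, $\mathrm{Var}(W)=(1-\lambda)P_s$ (a zero-variance Gaussian being the constant $0$). For a tuple $(R_1,R_2,S,T)$ of nonnegative reals consider $$(P)\quad\begin{aligned}&R_1\le I(Y_p;X_1|WX_2),\ R_2\le I(Y_p;X_2|WX_1),\ T\le I(Y_p;W|X_1X_2),\ R_1+R_2\le I(Y_p;X_1X_2|W),\\&R_1+T\le I(Y_p;WX_1|X_2),\ R_2+T\le I(Y_p;WX_2|X_1),\ R_1+R_2+T\le I(Y_p;WX_1X_2).\end{aligned}$$ $\mathcal{R}^o(Z)$ is the set of pairs $(R_s,R_p)=(S+T,R_1+R_2)$ with $(R_1,R_2,S,T)$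 nonnegative satisfying (P) and $S\le I(Y_s;U|W)$, $T\le I(Y_s;W|U)$, $S+T\le I(Y_s;UW)$. $\mathcal{R}_i^r(Z)$ is the set of pairs $(R_s,R_p)=(S+T,R_1+R_2)$ with $(R_1,R_2,S,T)$ nonnegative satisfying (P) and $$S\le I(Y_s;U|WX_i),\ T\le I(Y_s;W|UX_i),\ R_i\le I(Y_s;X_i|UW),\ S+T\le I(Y_s;UW|X_i),$$ $$R_i+S\le I(Y_s;UX_i|W),\ R_i+T\le I(Y_s;WX_i|U),\ R_i+S+T\le I(Y_s;UWX_i).$$ $\mathcal{R}^o_g$ and $\mathcal{R}^r_{ig}$ are the closures of $\bigcup_{Z\in\mathcal{G}(P_1,P_2,P_s)}\mathcal{R}^o(Z)$ and $\bigcup_{Z\in\mathcal{G}(P_1,P_2,P_s)}\mathcal{R}^r_i(Z)$, respectively. *)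

theory Defs
  imports "HOL-Probability.Probability"
begin

text \<open>Mutual information is in bits. The library places the conditioning in the chain rule
  \<open>I(A;B|C) = I(A;(B,C)) - I(A;C)\<close>. Below \<open>A\<close> is always a channel output, whose conditional law
  given the inputs is a nondegenerate Gaussian; so the laws involved are absolutely continuous and
  both terms are finite, even when \<open>B\<close> or \<open>C\<close> has constant components.\<close>

definition MI :: "'a measure \<Rightarrow> ('a \<Rightarrow> 'b::topological_space) \<Rightarrow> ('a \<Rightarrow> 'c::topological_space) \<Rightarrow> real"
  where "MI M A B = prob_space.mutual_information M 2 borel borel A B"

definition CMI :: "'a measure \<Rightarrow> ('a \<Rightarrow> 'b::topological_space) \<Rightarrow> ('a \<Rightarrow> 'c::topological_space) \<Rightarrow>
    ('a \<Rightarrow> 'd::topological_space) \<Rightarrow> real"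
  where "CMI M A B C = prob_space.conditional_mutual_information M 2 borel borel borel A B C"

definition joint :: "('a \<Rightarrow> 'b) \<Rightarrow> ('a \<Rightarrow> 'c) \<Rightarrow> 'a \<Rightarrow> 'b \<times> 'c" (infixr \<open>\<triangle>\<close> 65)
  where "A \<triangle> B = (\<lambda>\<omega>. (A \<omega>, B \<omega>))"

definition centered_gaussian :: "'a measure \<Rightarrow> ('a \<Rightarrow> real) \<Rightarrow> real \<Rightarrow> bool"
  where "centered_gaussian M A v \<longleftrightarrow> A \<in> borel_measurable M \<and>
    (if v = 0 then (AE \<omega> in M. A \<omega> = 0)
     else 0 < v \<and> distributed M lborel A (normal_density 0 (sqrt v)))"

record 'a tuple =
  pspace :: "'a measure"
  rvU :: "'a \<Rightarrow> real"
  rvW :: "'a \<Rightarrow> real"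
  rvX :: "nat \<Rightarrow> 'a \<Rightarrow> real" \<comment> \<open>only indices 1 and 2 are used\<close>
  rvXs :: "'a \<Rightarrow> real"
  rvYp :: "'a \<Rightarrow> real"
  rvYs :: "'a \<Rightarrow> real"

text \<open>Parameters: \<open>gp k\<close>, \<open>gsp\<close> are the gains $g_k^p$, $g_s^p$ to output $y_p$, and \<open>gs k\<close>, \<open>gss\<close>
  the gains $g_k^s$, $g_s^s$ to output $y_s$ (for \<open>k = 1, 2\<close>); \<open>P k\<close>, \<open>Ps\<close> are the powers.
  The last two entries of the independent list are the noises. Independence gives
  \<open>rvXs Z\<close> the variance \<open>Ps\<close>.\<close>

definition gaussian_tuple :: "(nat \<Rightarrow> real) \<Rightarrow> real \<Rightarrow> (nat \<Rightarrow> real) \<Rightarrow> real \<Rightarrow> real \<Rightarrow>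
    (nat \<Rightarrow> real) \<Rightarrow> real \<Rightarrow> real \<Rightarrow> 'a tuple \<Rightarrow> bool"
  where "gaussian_tuple gp gsp gs gss N0 P Ps lam Z \<longleftrightarrow>
    prob_space (pspace Z) \<and>
    centered_gaussian (pspace Z) (rvX Z 1) (P 1) \<and>
    centered_gaussian (pspace Z) (rvX Z 2) (P 2) \<and>
    centered_gaussian (pspace Z) (rvU Z) (lam * Ps) \<and>
    centered_gaussian (pspace Z) (rvW Z) ((1 - lam) * Ps) \<and>
    rvXs Z = (\<lambda>\<omega>. rvU Z \<omega> + rvW Z \<omega>) \<and>
    (\<exists>Np Ns.
      centered_gaussian (pspace Z) Np N0 \<and>
      centered_gaussian (pspace Z) Ns N0 \<and>
      prob_space.indep_vars (pspace Z) (\<lambda>_. borel)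
        (\<lambda>k. [rvX Z 1, rvX Z 2, rvU Z, rvW Z, Np, Ns] ! k) {..<6} \<and>
      rvYp Z = (\<lambda>\<omega>. sqrt (gp 1) * rvX Z 1 \<omega> + sqrt (gp 2) * rvX Z 2 \<omega>
                     + sqrt gsp * rvXs Z \<omega> + Np \<omega>) \<and>
      rvYs Z = (\<lambda>\<omega>. sqrt (gs 1) * rvX Z 1 \<omega> + sqrt (gs 2) * rvX Z 2 \<omega>
                     + sqrt gss * rvXs Z \<omega> + Ns \<omega>))"

text \<open>Everything derived from a tuple depends only on its joint law. The sample type
  \<open>nat \<Rightarrow> real\<close>, carrying an arbitrary probability space, is fixed because it realises every
  law that occurs here.\<close>

definition gaussian_family :: "(nat \<Rightarrow> real) \<Rightarrow> real \<Rightarrow> (nat \<Rightarrow> real) \<Rightarrow> real \<Rightarrow> real \<Rightarrow>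
    (nat \<Rightarrow> real) \<Rightarrow> real \<Rightarrow> (nat \<Rightarrow> real) tuple set"
  where "gaussian_family gp gsp gs gss N0 P Ps =
    {Z. \<exists>lam\<in>{0..1}. gaussian_tuple gp gsp gs gss N0 P Ps lam Z}"

definition primary_rates :: "'a tuple \<Rightarrow> (nat \<Rightarrow> real) \<Rightarrow> real \<Rightarrow> bool"
  where "primary_rates Z R T \<longleftrightarrow>
    R 1 \<le> CMI (pspace Z) (rvYp Z) (rvX Z 1) (rvW Z \<triangle> rvX Z 2) \<and>
    R 2 \<le> CMI (pspace Z) (rvYp Z) (rvX Z 2) (rvW Z \<triangle> rvX Z 1) \<and>
    T \<le> CMI (pspace Z) (rvYp Z) (rvW Z) (rvX Z 1 \<triangle> rvX Z 2) \<and>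
    R 1 + R 2 \<le> CMI (pspace Z) (rvYp Z) (rvX Z 1 \<triangle> rvX Z 2) (rvW Z) \<and>
    R 1 + T \<le> CMI (pspace Z) (rvYp Z) (rvW Z \<triangle> rvX Z 1) (rvX Z 2) \<and>
    R 2 + T \<le> CMI (pspace Z) (rvYp Z) (rvW Z \<triangle> rvX Z 2) (rvX Z 1) \<and>
    R 1 + R 2 + T \<le> MI (pspace Z) (rvYp Z) (rvW Z \<triangle> rvX Z 1 \<triangle> rvX Z 2)"

definition secondary_rates_o :: "'a tuple \<Rightarrow> real \<Rightarrow> real \<Rightarrow> bool"
  where "secondary_rates_o Z S T \<longleftrightarrow>
    S \<le> CMI (pspace Z) (rvYs Z) (rvU Z) (rvW Z) \<and>
    T \<le> CMI (pspace Z) (rvYs Z) (rvW Z) (rvU Z) \<and>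
    S + T \<le> MI (pspace Z) (rvYs Z) (rvU Z \<triangle> rvW Z)"

definition secondary_rates_r :: "nat \<Rightarrow> 'a tuple \<Rightarrow> real \<Rightarrow> real \<Rightarrow> real \<Rightarrow> bool"
  where "secondary_rates_r i Z Ri S T \<longleftrightarrow>
    S \<le> CMI (pspace Z) (rvYs Z) (rvU Z) (rvW Z \<triangle> rvX Z i) \<and>
    T \<le> CMI (pspace Z) (rvYs Z) (rvW Z) (rvU Z \<triangle> rvX Z i) \<and>
    Ri \<le> CMI (pspace Z) (rvYs Z) (rvX Z i) (rvU Z \<triangle> rvW Z) \<and>
    S + T \<le> CMI (pspace Z) (rvYs Z) (rvU Z \<triangle> rvW Z) (rvX Z i) \<and>
    Ri + S \<le> CMI (pspace Z) (rvYs Z) (rvU Z \<triangle> rvX Z i) (rvW Z) \<and>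
    Ri + T \<le> CMI (pspace Z) (rvYs Z) (rvW Z \<triangle> rvX Z i) (rvU Z) \<and>
    Ri + S + T \<le> MI (pspace Z) (rvYs Z) (rvU Z \<triangle> rvW Z \<triangle> rvX Z i)"

text \<open>Rate pairs are ordered \<open>(R\<^sub>s, R\<^sub>p)\<close>.\<close>

definition region_o :: "'a tuple \<Rightarrow> (real \<times> real) set"
  where "region_o Z = {(S + T, R 1 + R 2) | (R :: nat \<Rightarrow> real) S T.
    0 \<le> R 1 \<and> 0 \<le> R 2 \<and> 0 \<le> S \<and> 0 \<le> T \<and> primary_rates Z R T \<and> secondary_rates_o Z S T}"

definition region_r :: "nat \<Rightarrow> 'a tuple \<Rightarrow> (real \<times> real) set"
  where "region_r i Z = {(S + T, R 1 + R 2) | (R :: nat \<Rightarrow> real) S T.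
    0 \<le> R 1 \<and> 0 \<le> R 2 \<and> 0 \<le> S \<and> 0 \<le> T \<and> primary_rates Z R T \<and> secondary_rates_r i Z (R i) S T}"

definition gaussian_region_o :: "(nat \<Rightarrow> real) \<Rightarrow> real \<Rightarrow> (nat \<Rightarrow> real) \<Rightarrow> real \<Rightarrow> real \<Rightarrow>
    (nat \<Rightarrow> real) \<Rightarrow> real \<Rightarrow> (real \<times> real) set"
  where "gaussian_region_o gp gsp gs gss N0 P Ps =
    closure (\<Union>Z\<in>gaussian_family gp gsp gs gss N0 P Ps. region_o Z)"

definition gaussian_region_r :: "nat \<Rightarrow> (nat \<Rightarrow> real) \<Rightarrow> real \<Rightarrow> (nat \<Rightarrow> real) \<Rightarrow> real \<Rightarrow> real \<Rightarrow>
    (nat \<Rightarrow> real) \<Rightarrow> real \<Rightarrow> (real \<times> real) set"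
  where "gaussian_region_r i gp gsp gs gss N0 P Ps =
    closure (\<Union>Z\<in>gaussian_family gp gsp gs gss N0 P Ps. region_r i Z)"

end

theory Submission
  imports Defs
begin

text \<open>Every mutual information in question is that between a sum of independent centered Gaussians and
  some of its summands; the joint density of such a pair, taken with respect to the product of
  Lebesgue measure and the law of the summands, is a shifted Gaussian density, so degenerate
  summands need no separate treatment. This reduces all bounds to values of
  \<open>1/2 * log 2 (t / (t - s))\<close>, which is supermodular in \<open>s\<close>. For the inclusion, the tuple \<open>Z\<close> and the
  rates \<open>S\<close>, \<open>T\<close> are kept, while rate is transferred from \<open>i\<close> to \<open>j\<close> until
  \<open>R\<^sub>i \<le> I(Y\<^sub>p;X\<^sub>i|W) \<le> I(Y\<^sub>s;X\<^sub>i|UW)\<close>; the other constraints follow from the chain rule and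
  supermodularity.\<close>

section \<open>Linear combinations of independent centered Gaussians, degenerate ones
  included\<close>

lemma centered_gaussian_mult:
  assumes "prob_space M" and A: "centered_gaussian M A v"
  shows "centered_gaussian M (\<lambda>\<omega>. a * A \<omega>) (a\<^sup>2 * v)"
proof -
  interpret prob_space M by fact
  have [measurable]: "A \<in> borel_measurable M"
    using A by (simp add: centered_gaussian_def)
  show ?thesis
  proof (cases "a = 0 \<or> v = 0")
    case True
    then show ?thesis
      using A by (auto simp: centered_gaussian_def)
  next
    case False
    then have "0 < v" "distributed M lborel A (normal_density 0 (sqrt v))"
      using A by (auto simp: centered_gaussian_def)
    from normal_density_affine[OF this(2), of a 0] this(1) False show ?thesis
      by (simp add: centered_gaussian_def real_sqrt_mult)
  qed
qed

text \<open>Adding a summand of variance zero changes a variable only on a null set; this lemma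
  absorbs such summands.\<close>

lemma centered_gaussian_cong_AE:
  assumes A: "centered_gaussian M A v" and [measurable]: "B \<in> borel_measurable M"
    and eq: "AE \<omega> in M. A \<omega> = B \<omega>"
  shows "centered_gaussian M B v"
proof -
  have [measurable]: "A \<in> borel_measurable M"
    using A by (simp add: centered_gaussian_def)
  have "distr M lborel A = distr M lborel B"
    using eq by (intro distr_cong_AE) auto
  moreover have "(AE \<omega> in M. A \<omega> = 0) \<longleftrightarrow> (AE \<omega> in M. B \<omega> = 0)"
    using eq by (intro AE_cong_simp iffI; elim AE_mp) auto
  ultimately show ?thesis
    using A by (auto simp: centered_gaussian_def distributed_def split: if_splits)
qed

lemma centered_gaussian_add:
  assumes "prob_space M" and ind: "prob_space.indep_var M borel A borel B"
    and A: "centered_gaussian M A v" and B: "centered_gaussian M B w"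
  shows "centered_gaussian M (\<lambda>\<omega>. A \<omega> + B \<omega>) (v + w)"
proof -
  interpret prob_space M by fact
  have [measurable]: "A \<in> borel_measurable M" "B \<in> borel_measurable M"
    using A B by (simp_all add: centered_gaussian_def)
  \<comment> \<open>Convolution of normal densities covers two positive variances. Otherwise one
    summand vanishes almost surely and the sum agrees with the other one.\<close>
  consider "v = 0" | "w = 0" | "0 < v" "0 < w"
    using A B by (auto simp: centered_gaussian_def split: if_splits)
  then show ?thesis
  proof cases
    case 1
    then have "AE \<omega> in M. B \<omega> = A \<omega> + B \<omega>"
      using A by (auto simp: centered_gaussian_def)
    with 1 B show ?thesis by (auto intro: centered_gaussian_cong_AE)
  next
    case 2
    then have "AE \<omega> in M. A \<omega> = A \<omega> + B \<omega>"
      using B by (auto simp: centered_gaussian_def)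
    with 2 A show ?thesis by (auto intro: centered_gaussian_cong_AE)
  next
    case 3
    then have "distributed M lborel A (normal_density 0 (sqrt v))"
      "distributed M lborel B (normal_density 0 (sqrt w))"
      using A B by (auto simp: centered_gaussian_def)
    from add_indep_normal[OF ind _ _ this] 3 show ?thesis
      by (simp add: centered_gaussian_def)
  qed
qed

lemma centered_gaussian_sum:
  assumes "prob_space M" and "finite K" and "prob_space.indep_vars M (\<lambda>_. borel) X K"
    and "\<And>k. k \<in> K \<Longrightarrow> centered_gaussian M (X k) (v k)"
  shows "centered_gaussian M (\<lambda>\<omega>. \<Sum>k\<in>K. a k * X k \<omega>) (\<Sum>k\<in>K. (a k)\<^sup>2 * v k)"
  using assms(2-)
proof (induction K rule: finite_induct)
  case empty
  then show ?case by (simp add: centered_gaussian_def)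
next
  case (insert l K)
  interpret prob_space M by fact
  have "indep_vars (\<lambda>_. borel) (\<lambda>k \<omega>. a k * X k \<omega>) (insert l K)"
    using insert.prems(1) by (rule indep_vars_compose2[where Y="\<lambda>k x. a k * x"]) simp
  then have "indep_var borel (\<lambda>\<omega>. a l * X l \<omega>) borel (\<lambda>\<omega>. \<Sum>k\<in>K. a k * X k \<omega>)"
    using insert.hyps by (intro indep_vars_sum)
  moreover have "centered_gaussian M (\<lambda>\<omega>. a l * X l \<omega>) ((a l)\<^sup>2 * v l)"
    by (intro centered_gaussian_mult assms(1) insert.prems(2)) simp
  moreover have "centered_gaussian M (\<lambda>\<omega>. \<Sum>k\<in>K. a k * X k \<omega>) (\<Sum>k\<in>K. (a k)\<^sup>2 * v k)"
    using insert.prems indep_vars_subset[OF insert.prems(1), of K] by (intro insert.IH) auto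
  ultimately show ?case
    using insert.hyps centered_gaussian_add[OF \<open>prob_space M\<close>] by simp
qed

section \<open>Mutual information across additive Gaussian noise\<close>

text \<open>This is minus the differential entropy in bits. Its part independent of
  \<open>\<sigma>\<close> cancels when two such expectations are subtracted.\<close>

lemma expectation_log_normal_density:
  assumes "prob_space M" and D: "distributed M lborel A (normal_density 0 \<sigma>)" and [arith]: "0 < \<sigma>"
  shows "integrable M (\<lambda>\<omega>. log 2 (normal_density 0 \<sigma> (A \<omega>)))"
    and "(\<integral>\<omega>. log 2 (normal_density 0 \<sigma> (A \<omega>)) \<partial>M) = - log 2 \<sigma> - (ln (2 * pi) + 1) / (2 * ln 2)"
proof -
  interpret prob_space M by fact
  \<comment> \<open>The logarithm of the density is quadratic in \<open>x\<close>, so integrability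
    and value both reduce to the second moment.\<close>
  have log_eq: "log 2 (normal_density 0 \<sigma> x)
      = (- log 2 \<sigma> - ln (2 * pi) / (2 * ln 2)) - x\<^sup>2 / (2 * \<sigma>\<^sup>2 * ln 2)" for x
    by (simp add: normal_density_def log_def ln_mult ln_div ln_sqrt real_sqrt_mult field_simps)
  have int: "integrable M (\<lambda>\<omega>. (A \<omega>)\<^sup>2)"
    using integrable_normal_moment[of \<sigma> 0 2] distributed_integrable[OF D, of "\<lambda>x. x\<^sup>2"] by simp
  have sq: "(\<integral>\<omega>. (A \<omega>)\<^sup>2 \<partial>M) = \<sigma>\<^sup>2"
    using integral_normal_moment_even[of \<sigma> 0 1] distributed_integral[OF D, of "\<lambda>x. x\<^sup>2"]
    by (simp add: fact_numeral)
  show "integrable M (\<lambda>\<omega>. log 2 (normal_density 0 \<sigma> (A \<omega>)))"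
    unfolding log_eq using int by simp
  show "(\<integral>\<omega>. log 2 (normal_density 0 \<sigma> (A \<omega>)) \<partial>M) = - log 2 \<sigma> - (ln (2 * pi) + 1) / (2 * ln 2)"
    unfolding log_eq using int by (simp add: sq prob_space field_simps)
qed

text \<open>Given \<open>V = v\<close>, the output is the noise shifted by \<open>f v\<close>;
  Tonelli's theorem and translation invariance of Lebesgue measure turn this into a joint density.
  The law of \<open>V\<close> is itself the base measure of the second coordinate, so
  \<open>V\<close> may have constant components. Independence is stated through the joint law
  because \<open>V\<close> and \<open>N\<close> may have different types, while
  \<open>indep_var\<close> relates variables of one type.\<close>

lemma distributed_additive_noise:
  fixes N :: "'a \<Rightarrow> real" and f :: "'b::topological_space \<Rightarrow> real"
  assumes "prob_space M" and V[measurable]: "V \<in> measurable M borel"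
    and ind: "distr M (borel \<Otimes>\<^sub>M borel) (\<lambda>\<omega>. (V \<omega>, N \<omega>)) = distr M borel V \<Otimes>\<^sub>M distr M borel N"
    and D: "distributed M lborel N h"
    and f: "f \<in> borel_measurable borel"
  shows "distributed M (lborel \<Otimes>\<^sub>M distr M borel V) (\<lambda>\<omega>. (f (V \<omega>) + N \<omega>, V \<omega>))
    (\<lambda>p. h (fst p - f (snd p)))"
proof -
  interpret prob_space M by fact
  have [measurable]: "N \<in> borel_measurable M"
    using D by (simp add: distributed_def)
  define T where "T = distr M borel V"
  have sT[measurable_cong]: "sets T = sets borel" by (simp add: T_def)
  note f[measurable]
  have h[measurable]: "h \<in> borel_measurable borel"
    using D by (simp add: distributed_def)
  interpret T: prob_space T
    unfolding T_def by (rule prob_space_distr) simp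
  interpret LT: pair_sigma_finite lborel T ..
  have joint: "distr M (borel \<Otimes>\<^sub>M borel) (\<lambda>\<omega>. (V \<omega>, N \<omega>)) = T \<Otimes>\<^sub>M density lborel h"
  proof -
    have "distr M borel N = distr M lborel N"
      by (rule distr_cong) auto
    then show ?thesis
      using ind D by (simp add: T_def distributed_def)
  qed
  \<comment> \<open>The law of \<open>N\<close> is finite, which gives the sigma-finiteness for
    Tonelli's theorem in the noise coordinate.\<close>
  have "prob_space (density lborel h)"
    using D prob_space_distr[of N lborel] by (simp add: distributed_def)
  then interpret H: prob_space "density lborel h" .
  show ?thesis
    unfolding distributed_def T_def[symmetric]
  proof (intro conjI measure_eqI)
    fix S assume "S \<in> sets (distr M (lborel \<Otimes>\<^sub>M T) (\<lambda>\<omega>. (f (V \<omega>) + N \<omega>, V \<omega>)))"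
    then have S[measurable]: "S \<in> sets (lborel \<Otimes>\<^sub>M T)" by simp
    have S'[measurable]: "S \<in> sets (borel \<Otimes>\<^sub>M borel)" 
      using S by (metis sT sets_lborel sets_pair_measure_cong)
    have "emeasure (distr M (lborel \<Otimes>\<^sub>M T) (\<lambda>\<omega>. (f (V \<omega>) + N \<omega>, V \<omega>))) S
        = (\<integral>\<^sup>+\<omega>. indicator S (f (V \<omega>) + N \<omega>, V \<omega>) \<partial>M)"
      by (subst nn_integral_indicator[symmetric], simp) (subst nn_integral_distr, auto)
    also have "\<dots> = (\<integral>\<^sup>+p. indicator S (f (fst p) + snd p, fst p) \<partial>(T \<Otimes>\<^sub>M density lborel h))"
      unfolding joint[symmetric] by (subst nn_integral_distr) auto
    also have "\<dots> = (\<integral>\<^sup>+v. \<integral>\<^sup>+n. indicator S (f v + n, v) \<partial>density lborel h \<partial>T)"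
      by (subst H.nn_integral_fst[symmetric]) auto
    also have "\<dots> = (\<integral>\<^sup>+v. \<integral>\<^sup>+n. h n * indicator S (f v + n, v) \<partial>lborel \<partial>T)"
      by (intro nn_integral_cong, subst nn_integral_density) auto
    also have "\<dots> = (\<integral>\<^sup>+v. \<integral>\<^sup>+y. h (y - f v) * indicator S (y, v) \<partial>lborel \<partial>T)"
    proof (rule nn_integral_cong)
      fix v
      have "(\<lambda>y. h (y - f v) * indicator S (y, v)) \<in> borel_measurable borel"
        by measurable
      from nn_integral_real_affine[OF this, of 1 "f v"]
      show "(\<integral>\<^sup>+n. h n * indicator S (f v + n, v) \<partial>lborel)
          = (\<integral>\<^sup>+y. h (y - f v) * indicator S (y, v) \<partial>lborel)"
        by simp
    qed
    also have "\<dots> = (\<integral>\<^sup>+p. h (fst p - f (snd p)) * indicator S p \<partial>(lborel \<Otimes>\<^sub>M T))"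
      by (subst LT.nn_integral_snd[symmetric]) auto
    also have "\<dots> = emeasure (density (lborel \<Otimes>\<^sub>M T) (\<lambda>p. h (fst p - f (snd p)))) S"
      by (subst emeasure_density) auto
    finally show "emeasure (distr M (lborel \<Otimes>\<^sub>M T) (\<lambda>\<omega>. (f (V \<omega>) + N \<omega>, V \<omega>))) S
      = emeasure (density (lborel \<Otimes>\<^sub>M T) (\<lambda>p. h (fst p - f (snd p)))) S" .
  qed auto
qed

text \<open>The mutual information is the differential entropy of the output minus that of the
  noise. Both are Gaussian, so only their variances \<open>t\<close> and \<open>w\<close>
  enter.\<close>

lemma MI_additive_gaussian_noise:
  fixes N :: "'a \<Rightarrow> real" and V :: "'a \<Rightarrow> 'b::topological_space"
  assumes "prob_space M" and V[measurable]: "V \<in> measurable M borel"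
    and ind: "distr M (borel \<Otimes>\<^sub>M borel) (\<lambda>\<omega>. (V \<omega>, N \<omega>)) = distr M borel V \<Otimes>\<^sub>M distr M borel N"
    and N: "centered_gaussian M N w" and Y: "centered_gaussian M (\<lambda>\<omega>. f (V \<omega>) + N \<omega>) t"
    and pos: "0 < w" "0 < t"
    and f: "f \<in> borel_measurable borel"
  shows "MI M (\<lambda>\<omega>. f (V \<omega>) + N \<omega>) V = 1/2 * log 2 (t / w)"
proof -
  interpret information_space M 2
    using \<open>prob_space M\<close> by (simp add: information_space_def information_space_axioms_def)
  define T where "T = distr M borel V"
  define Y where "Y = (\<lambda>\<omega>. f (V \<omega>) + N \<omega>)"
  define \<sigma> \<tau> where "\<sigma> = sqrt w" and "\<tau> = sqrt t"
  have st[arith]: "0 < \<sigma>" "0 < \<tau>" using pos by (simp_all add: \<sigma>_def \<tau>_def)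
  have sT[measurable_cong]: "sets T = sets borel" by (simp add: T_def)
  note f[measurable]
  have DN: "distributed M lborel N (normal_density 0 \<sigma>)"
    and DY: "distributed M lborel Y (normal_density 0 \<tau>)"
    using assms by (auto simp: centered_gaussian_def \<sigma>_def \<tau>_def Y_def)
  interpret T: prob_space T
    unfolding T_def by (rule prob_space_distr) simp
  have DV: "distributed M T V (\<lambda>_. ennreal 1)"
  proof -
    have "distr M T V = T" unfolding T_def by (rule distr_cong) auto
    then show ?thesis by (simp add: distributed_def density_1)
  qed
  have DYV: "distributed M (lborel \<Otimes>\<^sub>M T) (\<lambda>\<omega>. (Y \<omega>, V \<omega>))
      (\<lambda>p. ennreal (normal_density 0 \<sigma> (fst p - f (snd p))))"
    unfolding Y_def T_def by (rule distributed_additive_noise[OF \<open>prob_space M\<close> V ind DN f])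
  \<comment> \<open>Mutual information depends on the target measures only through their
    sigma-algebras, so \<open>lborel\<close> and the law of \<open>V\<close> may replace
    \<open>borel\<close>.\<close>
  have "MI M Y V = mutual_information 2 lborel T Y V"
    unfolding MI_def mutual_information_def
    by (intro arg_cong2[where f="KL_divergence 2"] arg_cong2[where f=pair_measure] distr_cong
        sets_pair_measure_cong) (auto simp: sT)
  also have "\<dots> = (\<integral>p. normal_density 0 \<sigma> (fst p - f (snd p))
      * log 2 (normal_density 0 \<sigma> (fst p - f (snd p)) / (normal_density 0 \<tau> (fst p) * 1)) \<partial>(lborel \<Otimes>\<^sub>M T))"
    using lborel.sigma_finite_measure_axioms T.sigma_finite_measure_axioms DY _ DV _ DYV
    by (rule mutual_information_distr) auto
  \<comment> \<open>Integration against the joint density is an expectation, and subtracting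
    \<open>f (V \<omega>)\<close> from the output leaves the noise.\<close>
  also have "\<dots> = (\<integral>\<omega>. log 2 (normal_density 0 \<sigma> (N \<omega>) / normal_density 0 \<tau> (Y \<omega>)) \<partial>M)"
    by (subst distributed_integral[OF DYV]) (auto simp: Y_def)
  also have "\<dots> = (\<integral>\<omega>. log 2 (normal_density 0 \<sigma> (N \<omega>)) - log 2 (normal_density 0 \<tau> (Y \<omega>)) \<partial>M)"
    by (intro Bochner_Integration.integral_cong refl) (simp add: log_divide_pos normal_density_pos)
  also have "\<dots> = log 2 \<tau> - log 2 \<sigma>"
    using expectation_log_normal_density[OF \<open>prob_space M\<close> DN]
      expectation_log_normal_density[OF \<open>prob_space M\<close> DY] by simp
  also have "\<dots> = 1/2 * log 2 (t / w)"
    using pos by (simp add: \<sigma>_def \<tau>_def log_def ln_sqrt ln_div field_simps)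
  finally show ?thesis by (simp add: Y_def)
qed

text \<open>The components in \<open>A\<close> form the signal, the others the noise. Through
  \<open>g\<close>, \<open>V\<close> is a function of the former; through \<open>f\<close>, it
  determines their weighted sum. Hence the value does not depend on how \<open>V\<close> packs these
  components into a tuple.\<close>

lemma MI_gaussian_combination:
  fixes X :: "'k \<Rightarrow> 'a \<Rightarrow> real" and V :: "'a \<Rightarrow> 'b::topological_space"
  assumes "prob_space M" and K: "finite K" "A \<subseteq> K"
    and ind: "prob_space.indep_vars M (\<lambda>_. borel) X K"
    and X: "\<And>k. k \<in> K \<Longrightarrow> centered_gaussian M (X k) (v k)"
    and pos: "0 < (\<Sum>k\<in>K - A. (a k)\<^sup>2 * v k)"
    and V: "\<And>\<omega>. V \<omega> = g (restrict (\<lambda>k. X k \<omega>) A)" "g \<in> measurable (PiM A (\<lambda>_. borel)) borel"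
    and f: "\<And>\<omega>. f (V \<omega>) = (\<Sum>k\<in>A. a k * X k \<omega>)" "f \<in> borel_measurable borel"
  shows "MI M (\<lambda>\<omega>. \<Sum>k\<in>K. a k * X k \<omega>) V
    = 1/2 * log 2 ((\<Sum>k\<in>K. (a k)\<^sup>2 * v k) / (\<Sum>k\<in>K - A. (a k)\<^sup>2 * v k))"
proof -
  interpret prob_space M by fact
  define N where "N = (\<lambda>\<omega>. \<Sum>k\<in>K - A. a k * X k \<omega>)"
  have split: "(\<Sum>k\<in>K. a k * X k \<omega>) = f (V \<omega>) + N \<omega>" for \<omega>
    using K by (simp add: f N_def sum.subset_diff[of A K])
  define rA where "rA = (\<lambda>\<omega>. restrict (\<lambda>k. X k \<omega>) A)"
  define rB where "rB = (\<lambda>\<omega>. restrict (\<lambda>k. X k \<omega>) (K - A))"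
  define s where "s = (\<lambda>h. \<Sum>k\<in>K - A. a k * h k)"
  let ?P = "\<lambda>A. PiM A (\<lambda>_. borel)"
  \<comment> \<open>The restrictions to \<open>A\<close> and to \<open>K - A\<close> are
    independent; pushing their product law forward along \<open>g\<close> and \<open>s\<close> gives
    the product law of \<open>V\<close> and \<open>N\<close>.\<close>
  have "indep_var (?P A) rA (?P (K - A)) rB"
    unfolding rA_def rB_def using K by (intro indep_var_restrict[OF ind]) auto
  then have [measurable]: "rA \<in> measurable M (?P A)" "rB \<in> measurable M (?P (K - A))"
    and joint: "distr M (?P A) rA \<Otimes>\<^sub>M distr M (?P (K - A)) rB
      = distr M (?P A \<Otimes>\<^sub>M ?P (K - A)) (\<lambda>\<omega>. (rA \<omega>, rB \<omega>))"
    by (simp_all add: indep_var_distribution_eq)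
  note V(2)[measurable]
  have [measurable]: "s \<in> measurable (?P (K - A)) borel"
    unfolding s_def by measurable
  have V_eq: "V = (\<lambda>\<omega>. g (rA \<omega>))" and N_eq: "N = (\<lambda>\<omega>. s (rB \<omega>))"
    by (auto simp: V N_def rA_def rB_def s_def intro!: sum.cong)
  have VM: "V \<in> measurable M borel" "N \<in> measurable M borel"
    unfolding V_eq N_eq by measurable
  have "distr M borel V \<Otimes>\<^sub>M distr M borel N
      = distr (distr M (?P A) rA) borel g \<Otimes>\<^sub>M distr (distr M (?P (K - A)) rB) borel s"
    by (simp add: distr_distr V_eq N_eq comp_def)
  also have "\<dots> = distr (distr M (?P A) rA \<Otimes>\<^sub>M distr M (?P (K - A)) rB) (borel \<Otimes>\<^sub>M borel)
      (\<lambda>(x, y). (g x, s y))"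
    by (intro pair_measure_distr prob_space_imp_sigma_finite prob_space.prob_space_distr prob_space_distr)
      auto
  also have "\<dots> = distr M (borel \<Otimes>\<^sub>M borel) (\<lambda>\<omega>. (V \<omega>, N \<omega>))"
    unfolding joint by (subst distr_distr) (auto simp: V_eq N_eq comp_def)
  finally have VN: "distr M (borel \<Otimes>\<^sub>M borel) (\<lambda>\<omega>. (V \<omega>, N \<omega>)) = distr M borel V \<Otimes>\<^sub>M distr M borel N" ..
  have N: "centered_gaussian M N (\<Sum>k\<in>K - A. (a k)\<^sup>2 * v k)"
    unfolding N_def using K X indep_vars_subset[OF ind]
    by (intro centered_gaussian_sum assms(1)) auto
  have Y: "centered_gaussian M (\<lambda>\<omega>. f (V \<omega>) + N \<omega>) (\<Sum>k\<in>K. (a k)\<^sup>2 * v k)"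
    unfolding split[symmetric] using K X ind by (intro centered_gaussian_sum assms(1)) auto
  have "0 \<le> v k" if "k \<in> K" for k
    using X[OF that] by (auto simp: centered_gaussian_def split: if_splits)
  then have "0 < (\<Sum>k\<in>K. (a k)\<^sup>2 * v k)"
    using K by (intro less_le_trans[OF pos] sum_mono2) auto
  then show ?thesis
    unfolding split using pos f(2) by (intro MI_additive_gaussian_noise[OF assms(1) VM(1) VN N Y])
qed

section \<open>Chain rule and supermodularity of Gaussian information\<close>

text \<open>The chain rule is the definition here; second countability identifies
  \<open>borel\<close> on a product type with the product of the two Borel algebras.\<close>

lemma CMI_eq_MI_diff:
  fixes B :: "'a \<Rightarrow> 'b::second_countable_topology" and C :: "'a \<Rightarrow> 'c::second_countable_topology"
  assumes "prob_space M"
  shows "CMI M A B C = MI M A (B \<triangle> C) - MI M A C"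
  using assms
  by (simp add: CMI_def MI_def joint_def prob_space.conditional_mutual_information_def borel_prod)

text \<open>The information that an output of variance \<open>t\<close> carries about those of its independent
  Gaussian components whose variances add up to \<open>s\<close>.\<close>

definition gaussian_info :: "real \<Rightarrow> real \<Rightarrow> real"
  where "gaussian_info t s = 1/2 * log 2 (t / (t - s))"

lemma gaussian_info_0: "0 < t \<Longrightarrow> gaussian_info t 0 = 0"
  by (simp add: gaussian_info_def)

text \<open>Once components of total variance \<open>s\<close> are known, a further one of variance
  \<open>a\<close> is received against the remaining variance \<open>t - s - a\<close>, which acts
  as noise.\<close>

lemma gaussian_info_add:
  assumes "0 \<le> a" "0 \<le> s" "s + a < t"
  shows "gaussian_info t (s + a) - gaussian_info t s = 1/2 * log 2 (1 + a / (t - s - a))"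
proof -
  have "1 + a / (t - s - a) = (t - s) / (t - (s + a))"
    using assms by (simp add: divide_simps)
  moreover have "log 2 ((t - s) / (t - (s + a))) = log 2 (t - s) - log 2 (t - (s + a))"
    using assms by (intro log_divide_pos) auto
  ultimately show ?thesis
    using assms by (simp add: gaussian_info_def log_divide field_simps)
qed

text \<open>The increment for a component of variance \<open>a\<close> is governed by
  \<open>a / (t - s - a)\<close>, which grows with \<open>s\<close>: knowing more components leaves
  less noise.\<close>

lemma gaussian_info_supermodular:
  assumes "0 \<le> a" "0 \<le> b" "0 \<le> s" "s + a + b < t"
  shows "gaussian_info t (s + a) + gaussian_info t (s + b)
    \<le> gaussian_info t (s + a + b) + gaussian_info t s"
proof -
  have "gaussian_info t (s + a) - gaussian_info t s
      \<le> gaussian_info t (s + b + a) - gaussian_info t (s + b)"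
    using assms by (subst (1 2) gaussian_info_add) (auto intro!: log_mono add_mono divide_left_mono
        mult_pos_pos add_pos_nonneg)
  then show ?thesis by (simp add: algebra_simps)
qed

lemma gaussian_info_mono:
  assumes "0 \<le> a" "0 \<le> s" "s + a < t"
  shows "gaussian_info t s \<le> gaussian_info t (s + a)"
proof -
  have "0 \<le> a / (t - s - a)"
    using assms by simp
  then have "0 \<le> 1/2 * log 2 (1 + a / (t - s - a))"
    by simp
  then show ?thesis
    using gaussian_info_add[OF assms] by simp
qed

section \<open>Information about the components of one output\<close>

text \<open>Both channel outputs are instances over the same components. The component
  \<open>z\<close> is the noise of the output: it stays outside the known set, which keeps the
  residual variance positive. Other components may have coefficient or variance zero.\<close>

locale gaussian_combination = prob_space M for M :: "'a measure" +
  fixes K :: "'k set" and X :: "'k \<Rightarrow> 'a \<Rightarrow> real" and v a :: "'k \<Rightarrow> real"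
    and Y :: "'a \<Rightarrow> real" and z :: 'k
  assumes finite_K: "finite K"
    and indep_X: "indep_vars (\<lambda>_. borel) X K"
    and gaussian_X: "k \<in> K \<Longrightarrow> centered_gaussian M (X k) (v k)"
    and Y_eq: "Y = (\<lambda>\<omega>. \<Sum>k\<in>K. a k * X k \<omega>)"
    and noise: "z \<in> K" "0 < (a z)\<^sup>2 * v z"
begin

definition component_variance :: "'k \<Rightarrow> real"
  where "component_variance k = (a k)\<^sup>2 * v k"

lemma component_variance_nonneg: "k \<in> K \<Longrightarrow> 0 \<le> component_variance k"
  using gaussian_X[of k] by (auto simp: component_variance_def centered_gaussian_def split: if_splits)

lemma MI_components:
  fixes V :: "'a \<Rightarrow> 'b::topological_space"
  assumes A: "A \<subseteq> K - {z}"
    and V: "\<And>\<omega>. V \<omega> = g (restrict (\<lambda>k. X k \<omega>) A)" "g \<in> measurable (PiM A (\<lambda>_. borel)) borel"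
    and f: "\<And>\<omega>. f (V \<omega>) = (\<Sum>k\<in>A. a k * X k \<omega>)" "f \<in> borel_measurable borel"
  shows "MI M Y V = gaussian_info (\<Sum>k\<in>K. component_variance k) (\<Sum>k\<in>A. component_variance k)"
proof -
  have "0 < (\<Sum>k\<in>K - A. component_variance k)"
    using A noise finite_K component_variance_nonneg
    by (intro sum_pos2[of _ z]) (auto simp: component_variance_def)
  moreover have "(\<Sum>k\<in>K - A. component_variance k) = (\<Sum>k\<in>K. component_variance k) - (\<Sum>k\<in>A. component_variance k)"
    using A finite_K by (intro sum_diff) auto
  ultimately show ?thesis
    using MI_gaussian_combination[OF prob_space_axioms finite_K _ indep_X gaussian_X _ V f] A
    by (auto simp: gaussian_info_def component_variance_def Y_eq)
qed

lemma MI_1: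
  assumes "k \<in> K - {z}"
  shows "MI M Y (X k) = gaussian_info (\<Sum>k\<in>K. component_variance k) (component_variance k)"
  using MI_components[of "{k}" "X k" "\<lambda>h. h k" "\<lambda>x. a k * x"] assms by simp

lemma MI_2:
  assumes "k \<in> K - {z}" "l \<in> K - {z}" "k \<noteq> l"
  shows "MI M Y (X k \<triangle> X l) = gaussian_info (\<Sum>k\<in>K. component_variance k) (component_variance k + component_variance l)"
proof -
  have "(\<lambda>h. (h k, h l)) \<in> PiM {k, l} (\<lambda>_. borel) \<rightarrow>\<^sub>M (borel :: (real \<times> real) measure)"
    unfolding borel_prod[symmetric] by measurable
  moreover have "(\<lambda>(x, y). a k * x + a l * y) \<in> borel_measurable (borel :: (real \<times> real) measure)"
    unfolding borel_prod[symmetric] by measurable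
  ultimately show ?thesis
    using MI_components[of "{k, l}" "X k \<triangle> X l" "\<lambda>h. (h k, h l)" "\<lambda>(x, y). a k * x + a l * y"] assms
    by (simp add: joint_def)
qed

text \<open>Both nestings occur: in \<open>CMI_eq_MI_diff\<close> the argument
  \<open>B \<triangle> C\<close> nests to the left if \<open>B\<close> is a pair and to the right if
  \<open>C\<close> is.\<close>

lemma MI_3:
  assumes "k \<in> K - {z}" "l \<in> K - {z}" "m \<in> K - {z}" "k \<noteq> l" "k \<noteq> m" "l \<noteq> m"
  shows "MI M Y (X k \<triangle> X l \<triangle> X m)
    = gaussian_info (\<Sum>k\<in>K. component_variance k) (component_variance k + component_variance l + component_variance m)"
    and "MI M Y ((X k \<triangle> X l) \<triangle> X m)
    = gaussian_info (\<Sum>k\<in>K. component_variance k) (component_variance k + component_variance l + component_variance m)"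
proof -
  have "(\<lambda>h. (h k, h l, h m)) \<in> PiM {k, l, m} (\<lambda>_. borel) \<rightarrow>\<^sub>M (borel :: (real \<times> real \<times> real) measure)"
    unfolding borel_prod[symmetric] by measurable
  moreover have "(\<lambda>(x, y, w). a k * x + a l * y + a m * w)
      \<in> borel_measurable (borel :: (real \<times> real \<times> real) measure)"
    unfolding borel_prod[symmetric] by measurable
  ultimately show "MI M Y (X k \<triangle> X l \<triangle> X m)
    = gaussian_info (\<Sum>k\<in>K. component_variance k) (component_variance k + component_variance l + component_variance m)"
    using MI_components[of "{k, l, m}" "X k \<triangle> X l \<triangle> X m" "\<lambda>h. (h k, h l, h m)"
        "\<lambda>(x, y, w). a k * x + a l * y + a m * w"] assms
    by (simp add: joint_def add.assoc)
next
  have "(\<lambda>h. ((h k, h l), h m)) \<in> PiM {k, l, m} (\<lambda>_. borel)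
      \<rightarrow>\<^sub>M (borel :: ((real \<times> real) \<times> real) measure)"
    unfolding borel_prod[symmetric] by measurable
  moreover have "(\<lambda>p. a k * fst (fst p) + a l * snd (fst p) + a m * snd p)
      \<in> borel_measurable (borel :: ((real \<times> real) \<times> real) measure)"
    unfolding borel_prod[symmetric] by measurable
  ultimately show "MI M Y ((X k \<triangle> X l) \<triangle> X m)
    = gaussian_info (\<Sum>k\<in>K. component_variance k) (component_variance k + component_variance l + component_variance m)"
    using MI_components[of "{k, l, m}" "(X k \<triangle> X l) \<triangle> X m" "\<lambda>h. ((h k, h l), h m)"
        "\<lambda>p. a k * fst (fst p) + a l * snd (fst p) + a m * snd p"] assms
    by (simp add: joint_def add.assoc)
qed

end

section \<open>Gaussian tuples: rate bounds in closed form, and existence\<close>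

text \<open>Substituting \<open>U + W\<close> for the secondary input makes each output a
  combination of the same six independent variables. \<open>U\<close> and \<open>W\<close> share a
  coefficient, and the noise of the other output has coefficient 0. Indices 4 and 5 are the two
  noises.\<close>

lemma gaussian_tuple_combinations:
  assumes Z: "gaussian_tuple gp gsp gs gss N0 P Ps lam Z"
    and "0 < gsp" "0 < gss" "0 < N0"
  obtains X where
    "rvX Z 1 = X 0" "rvX Z 2 = X 1" "rvU Z = X 2" "rvW Z = X 3"
    "gaussian_combination (pspace Z) {..<6} X (\<lambda>k. [P 1, P 2, lam * Ps, (1 - lam) * Ps, N0, N0] ! k)
      (\<lambda>k. [sqrt (gp 1), sqrt (gp 2), sqrt gsp, sqrt gsp, 1, 0] ! k) (rvYp Z) (4::nat)"
    "gaussian_combination (pspace Z) {..<6} X (\<lambda>k. [P 1, P 2, lam * Ps, (1 - lam) * Ps, N0, N0] ! k)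
      (\<lambda>k. [sqrt (gs 1), sqrt (gs 2), sqrt gss, sqrt gss, 0, 1] ! k) (rvYs Z) 5"
proof -
  interpret prob_space "pspace Z"
    using Z by (simp add: gaussian_tuple_def)
  obtain Np Ns where N: "centered_gaussian (pspace Z) Np N0" "centered_gaussian (pspace Z) Ns N0"
    and ind: "indep_vars (\<lambda>_. borel) (\<lambda>k. [rvX Z 1, rvX Z 2, rvU Z, rvW Z, Np, Ns] ! k) {..<6}"
    and Y: "rvYp Z = (\<lambda>\<omega>. sqrt (gp 1) * rvX Z 1 \<omega> + sqrt (gp 2) * rvX Z 2 \<omega>
                     + sqrt gsp * rvXs Z \<omega> + Np \<omega>)"
      "rvYs Z = (\<lambda>\<omega>. sqrt (gs 1) * rvX Z 1 \<omega> + sqrt (gs 2) * rvX Z 2 \<omega>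
                     + sqrt gss * rvXs Z \<omega> + Ns \<omega>)"
    using Z unfolding gaussian_tuple_def by blast
  define X where "X = (\<lambda>k. [rvX Z 1, rvX Z 2, rvU Z, rvW Z, Np, Ns] ! k)"
  have set6: "{..<6::nat} = {0, 1, 2, 3, 4, 5}" by auto
  have cg: "centered_gaussian (pspace Z) (X k) ([P 1, P 2, lam * Ps, (1 - lam) * Ps, N0, N0] ! k)"
    if "k \<in> {..<6}" for k
    using that Z N unfolding set6 by (auto simp: X_def gaussian_tuple_def)
  have Xs: "rvXs Z = (\<lambda>\<omega>. rvU Z \<omega> + rvW Z \<omega>)"
    using Z by (simp add: gaussian_tuple_def)
  show thesis
  proof (rule that[of X])
    show "gaussian_combination (pspace Z) {..<6} X (\<lambda>k. [P 1, P 2, lam * Ps, (1 - lam) * Ps, N0, N0] ! k)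
        (\<lambda>k. [sqrt (gp 1), sqrt (gp 2), sqrt gsp, sqrt gsp, 1, 0] ! k) (rvYp Z) 4"
      using ind cg \<open>0 < N0\<close>
      by unfold_locales (auto simp: Y Xs X_def set6 algebra_simps)
    show "gaussian_combination (pspace Z) {..<6} X (\<lambda>k. [P 1, P 2, lam * Ps, (1 - lam) * Ps, N0, N0] ! k)
        (\<lambda>k. [sqrt (gs 1), sqrt (gs 2), sqrt gss, sqrt gss, 0, 1] ! k) (rvYs Z) 5"
      using ind cg \<open>0 < N0\<close>
      by unfold_locales (auto simp: Y Xs X_def set6 algebra_simps)
  qed (simp_all add: X_def)
qed

text \<open>This lets a statement about all tuples be specialised to a given \<open>lam\<close>. The
  tuple consists of the coordinates of a product of six laws.\<close>

lemma exists_gaussian_tuple: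
  assumes lam: "lam \<in> {0..1}" and pos: "0 < P 1" "0 < P 2" "0 < Ps" "0 < N0"
  shows "\<exists>Z :: (nat \<Rightarrow> real) tuple. gaussian_tuple gp gsp gs gss N0 P Ps lam Z"
proof -
  define v where "v = (\<lambda>k. [P 1, P 2, lam * Ps, (1 - lam) * Ps, N0, N0] ! k)"
  \<comment> \<open>At \<open>lam = 0\<close> or \<open>lam = 1\<close> one of \<open>U\<close> and
    \<open>W\<close> has variance zero, and its law is the point mass at 0.\<close>
  define \<mu> :: "nat \<Rightarrow> real measure" where "\<mu> = (\<lambda>k. if v k = 0 then return borel 0
    else density lborel (normal_density 0 (sqrt (v k))))"
  have set6: "{..<6::nat} = {0, 1, 2, 3, 4, 5}" by auto
  have v: "0 \<le> v k" if "k \<in> {..<6}" for k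
    using that lam pos unfolding set6 by (auto simp: v_def)
  have \<mu>: "prob_space (\<mu> k)" if "k \<in> {..<6}" for k
    using v[OF that] by (auto simp: \<mu>_def intro!: prob_space_return prob_space_normal_density)
  have sets_\<mu>[measurable_cong, simp]: "sets (\<mu> k) = sets borel" for k
    by (simp add: \<mu>_def)
  define M where "M = PiM {..<6} \<mu>"
  interpret prob_space M
    unfolding M_def by (rule prob_space_PiM) (rule \<mu>)
  have meas[measurable]: "(\<lambda>\<omega>. \<omega> k) \<in> borel_measurable M" if "k \<in> {..<6}" for k
    unfolding M_def using that by measurable
  have distr: "distr M borel (\<lambda>\<omega>. \<omega> k) = \<mu> k" if "k \<in> {..<6}" for k
  proof -
    have "distr M borel (\<lambda>\<omega>. \<omega> k) = distr M (\<mu> k) (\<lambda>\<omega>. \<omega> k)"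
      by (rule distr_cong) auto
    also have "\<dots> = \<mu> k"
      unfolding M_def by (rule distr_PiM_component[OF \<mu> that])
    finally show ?thesis .
  qed
  have cg: "centered_gaussian M (\<lambda>\<omega>. \<omega> k) (v k)" if k: "k \<in> {..<6}" for k
  proof (cases "v k = 0")
    case True
    then have \<mu>_k: "\<mu> k = return borel 0"
      by (simp add: \<mu>_def)
    have "AE x in distr M borel (\<lambda>\<omega>. \<omega> k). x = 0"
      unfolding distr[OF k] \<mu>_k by (subst AE_return) auto
    with True k show ?thesis
      by (simp add: centered_gaussian_def AE_distr_iff)
  next
    case False
    have "distr M lborel (\<lambda>\<omega>. \<omega> k) = distr M borel (\<lambda>\<omega>. \<omega> k)"
      by (rule distr_cong) auto
    with False v[OF k] k show ?thesis
      by (simp add: centered_gaussian_def distributed_def distr \<mu>_def)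
  qed
  have ind: "indep_vars (\<lambda>_. borel) (\<lambda>k \<omega>. \<omega> k) {..<6}"
  proof -
    \<comment> \<open>Points of \<open>M\<close> are extensional on \<open>{..<6}\<close>, so
      restriction to these indices is the identity on its space.\<close>
    have "distr M (PiM {..<6} (\<lambda>_. borel)) (\<lambda>\<omega>. \<lambda>k\<in>{..<6}. \<omega> k) = distr M M (\<lambda>\<omega>. \<omega>)"
      by (rule distr_cong) (auto simp: M_def space_PiM PiE_restrict intro!: sets_PiM_cong)
    also have "\<dots> = PiM {..<6} \<mu>"
      by (simp add: M_def)
    also have "\<dots> = PiM {..<6} (\<lambda>k. distr M borel (\<lambda>\<omega>. \<omega> k))"
      by (intro PiM_cong refl distr[symmetric])
    finally show ?thesis
      using set6 by (subst indep_vars_iff_distr_eq_PiM') auto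
  qed
  define Y where "Y = (\<lambda>g gx n (\<omega> :: nat \<Rightarrow> real). sqrt (g (1::nat)) * \<omega> 0 + sqrt (g 2) * \<omega> 1
    + sqrt gx * (\<omega> 2 + \<omega> 3) + \<omega> n)"
  \<comment> \<open>The shift \<open>k - 1\<close> makes the inputs with indices 1 and 2 the
    coordinates 0 and 1.\<close>
  define Z where "Z = \<lparr>pspace = M, rvU = (\<lambda>\<omega>. \<omega> 2), rvW = (\<lambda>\<omega>. \<omega> 3),
    rvX = (\<lambda>k \<omega>. \<omega> (k - 1)), rvXs = (\<lambda>\<omega>. \<omega> 2 + \<omega> 3), rvYp = Y gp gsp 4, rvYs = Y gs gss 5\<rparr>"
  have "indep_vars (\<lambda>_. borel)
      (\<lambda>k. [rvX Z 1, rvX Z 2, rvU Z, rvW Z, \<lambda>\<omega>. \<omega> 4, \<lambda>\<omega>. \<omega> 5] ! k) {..<6}"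
    by (subst indep_vars_cong[OF refl _ refl, of _ _ "\<lambda>k \<omega>. \<omega> k"])
      (use ind in \<open>auto simp: set6 Z_def\<close>)
  moreover have "centered_gaussian M (\<lambda>\<omega>. \<omega> 4) N0" "centered_gaussian M (\<lambda>\<omega>. \<omega> 5) N0"
    using cg[of 4] cg[of 5] by (simp_all add: v_def)
  moreover have "rvYp Z = (\<lambda>\<omega>. sqrt (gp 1) * rvX Z 1 \<omega> + sqrt (gp 2) * rvX Z 2 \<omega>
      + sqrt gsp * rvXs Z \<omega> + \<omega> 4)"
    "rvYs Z = (\<lambda>\<omega>. sqrt (gs 1) * rvX Z 1 \<omega> + sqrt (gs 2) * rvX Z 2 \<omega>
      + sqrt gss * rvXs Z \<omega> + \<omega> 5)"
    by (simp_all add: Z_def Y_def)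
  ultimately have "\<exists>Np Ns. centered_gaussian (pspace Z) Np N0 \<and> centered_gaussian (pspace Z) Ns N0 \<and>
      prob_space.indep_vars (pspace Z) (\<lambda>_. borel)
        (\<lambda>k. [rvX Z 1, rvX Z 2, rvU Z, rvW Z, Np, Ns] ! k) {..<6} \<and>
      rvYp Z = (\<lambda>\<omega>. sqrt (gp 1) * rvX Z 1 \<omega> + sqrt (gp 2) * rvX Z 2 \<omega>
                     + sqrt gsp * rvXs Z \<omega> + Np \<omega>) \<and>
      rvYs Z = (\<lambda>\<omega>. sqrt (gs 1) * rvX Z 1 \<omega> + sqrt (gs 2) * rvX Z 2 \<omega>
                     + sqrt gss * rvXs Z \<omega> + Ns \<omega>)"
    by (intro exI[of _ "\<lambda>\<omega>. \<omega> 4"] exI[of _ "\<lambda>\<omega>. \<omega> 5"]) (simp add: Z_def)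
  then have "gaussian_tuple gp gsp gs gss N0 P Ps lam Z"
    unfolding gaussian_tuple_def
    using cg[of 0] cg[of 1] cg[of 2] cg[of 3] prob_space_axioms
    by (simp add: Z_def v_def)
  then show ?thesis ..
qed

text \<open>By the chain rule each bound is a difference of values of \<open>Ip\<close> or
  \<open>Is\<close> at sums of component variances. Writing everything in \<open>i\<close> and
  \<open>j\<close> settles the two cases of \<open>i\<close> once, so later arguments are uniform in
  \<open>i\<close>.\<close>

lemma gaussian_tuple_MI:
  assumes Z: "gaussian_tuple gp gsp gs gss N0 P Ps lam Z"
    and pos: "0 < gp 1" "0 < gp 2" "0 < gsp" "0 < gs 1" "0 < gs 2" "0 < gss" "0 < N0"
    and ij: "i \<in> {1, 2}" "j \<in> {1, 2}" "j \<noteq> i"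
  defines "Ip \<equiv> gaussian_info (gp i * P i + gp j * P j + gsp * lam * Ps + gsp * (1 - lam) * Ps + N0)"
    and "Is \<equiv> gaussian_info (gs i * P i + gs j * P j + gss * lam * Ps + gss * (1 - lam) * Ps + N0)"
    and "wp \<equiv> gsp * (1 - lam) * Ps" and "us \<equiv> gss * lam * Ps" and "ws \<equiv> gss * (1 - lam) * Ps"
  shows "primary_rates Z R T \<longleftrightarrow>
      R i \<le> Ip (wp + gp i * P i + gp j * P j) - Ip (wp + gp j * P j) \<and>
      R j \<le> Ip (wp + gp i * P i + gp j * P j) - Ip (wp + gp i * P i) \<and>
      T \<le> Ip (wp + gp i * P i + gp j * P j) - Ip (gp i * P i + gp j * P j) \<and>
      R i + R j \<le> Ip (wp + gp i * P i + gp j * P j) - Ip wp \<and>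
      R i + T \<le> Ip (wp + gp i * P i + gp j * P j) - Ip (gp j * P j) \<and>
      R j + T \<le> Ip (wp + gp i * P i + gp j * P j) - Ip (gp i * P i) \<and>
      R i + R j + T \<le> Ip (wp + gp i * P i + gp j * P j)" (is ?p)
    and "secondary_rates_o Z S T \<longleftrightarrow>
      S \<le> Is (us + ws) - Is ws \<and> T \<le> Is (us + ws) - Is us \<and> S + T \<le> Is (us + ws)" (is ?o)
    and "secondary_rates_r i Z Ri S T \<longleftrightarrow>
      S \<le> Is (us + ws + gs i * P i) - Is (ws + gs i * P i) \<and>
      T \<le> Is (us + ws + gs i * P i) - Is (us + gs i * P i) \<and>
      Ri \<le> Is (us + ws + gs i * P i) - Is (us + ws) \<and>
      S + T \<le> Is (us + ws + gs i * P i) - Is (gs i * P i) \<and>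
      Ri + S \<le> Is (us + ws + gs i * P i) - Is ws \<and>
      Ri + T \<le> Is (us + ws + gs i * P i) - Is us \<and>
      Ri + S + T \<le> Is (us + ws + gs i * P i)" (is ?r)
    and "CMI (pspace Z) (rvYp Z) (rvX Z i) (rvW Z) = Ip (wp + gp i * P i) - Ip wp" (is ?cp)
    and "CMI (pspace Z) (rvYs Z) (rvX Z i) (rvU Z \<triangle> rvW Z)
      = Is (us + ws + gs i * P i) - Is (us + ws)" (is ?cs)
proof -
  define v where "v = (\<lambda>k. [P 1, P 2, lam * Ps, (1 - lam) * Ps, N0, N0] ! k)"
  define ap where "ap = (\<lambda>k. [sqrt (gp 1), sqrt (gp 2), sqrt gsp, sqrt gsp, 1, 0] ! k)"
  define as where "as = (\<lambda>k. [sqrt (gs 1), sqrt (gs 2), sqrt gss, sqrt gss, 0, 1] ! k)"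
  obtain X where X: "rvX Z 1 = X 0" "rvX Z 2 = X 1" "rvU Z = X 2" "rvW Z = X 3"
    and p: "gaussian_combination (pspace Z) {..<6} X v ap (rvYp Z) (4::nat)"
    and s: "gaussian_combination (pspace Z) {..<6} X v as (rvYs Z) 5"
    using gaussian_tuple_combinations[OF Z pos(3,6,7)] unfolding v_def ap_def as_def by metis
  interpret p: gaussian_combination "pspace Z" "{..<6}" X v ap "rvYp Z" "4::nat" by (rule p)
  interpret s: gaussian_combination "pspace Z" "{..<6}" X v as "rvYs Z" 5 by (rule s)
  have set6: "{..<6::nat} = {0, 1, 2, 3, 4, 5}" by auto
  have pp: "p.component_variance 0 = gp 1 * P 1" "p.component_variance 1 = gp 2 * P 2" "p.component_variance 3 = wp"
    using pos unfolding p.component_variance_def by (simp_all add: v_def ap_def wp_def)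
  have ps: "s.component_variance 0 = gs 1 * P 1" "s.component_variance 1 = gs 2 * P 2" "s.component_variance 2 = us"
    "s.component_variance 3 = ws"
    using pos unfolding s.component_variance_def by (simp_all add: v_def as_def us_def ws_def)
  have Ip: "gaussian_info (\<Sum>k<6. p.component_variance k) = Ip"
    using ij pos unfolding p.component_variance_def by (auto simp: Ip_def v_def ap_def set6 algebra_simps)
  have Is: "gaussian_info (\<Sum>k<6. s.component_variance k) = Is"
    using ij pos unfolding s.component_variance_def by (auto simp: Is_def v_def as_def set6 algebra_simps)
  note MI = CMI_eq_MI_diff[OF p.prob_space_axioms] p.MI_1 p.MI_2 p.MI_3 s.MI_1 s.MI_2 s.MI_3
  consider "i = 1" "j = 2" | "i = 2" "j = 1" using ij by auto
  then have "?p \<and> ?o \<and> ?r \<and> ?cp \<and> ?cs"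
  proof cases
    case 1
    show ?thesis
      unfolding 1 primary_rates_def secondary_rates_o_def secondary_rates_r_def X
      by (auto simp: MI Ip Is pp[unfolded One_nat_def] ps[unfolded One_nat_def] ac_simps)
  next
    case 2
    show ?thesis
      unfolding 2 primary_rates_def secondary_rates_o_def secondary_rates_r_def X
      by (auto simp: MI Ip Is pp[unfolded One_nat_def] ps[unfolded One_nat_def] ac_simps)
  qed
  then show ?p ?o ?r ?cp ?cs by blast+
qed

section \<open>Comparison of signal-to-noise ratios\<close>

lemma log_SINR_mono:
  assumes "0 < n" "n \<le> n'" "0 \<le> (a::real)"
  shows "1/2 * log 2 (1 + a / n') \<le> 1/2 * log 2 (1 + a / n)"
  using assms by (auto intro!: log_mono divide_left_mono add_pos_nonneg)

lemma log_SINR_le_iff: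
  assumes "0 < n" "0 < m" "0 < (p::real)" "0 \<le> g" "0 \<le> h"
  shows "1/2 * log 2 (1 + g * p / n) \<le> 1/2 * log 2 (1 + h * p / m) \<longleftrightarrow> g / n \<le> h / m"
proof -
  have "0 < 1 + g * p / n" "0 < 1 + h * p / m"
    using assms by (auto intro!: add_pos_nonneg)
  then have "1/2 * log 2 (1 + g * p / n) \<le> 1/2 * log 2 (1 + h * p / m)
      \<longleftrightarrow> (g / n) * p \<le> (h / m) * p"
    by simp
  also have "\<dots> \<longleftrightarrow> g / n \<le> h / m"
    using assms by (intro mult_le_cancel_right_pos)
  finally show ?thesis .
qed

section \<open>Rate transfer and inclusion of the regions of one tuple\<close>

text \<open>\<open>Mw\<close>, \<open>Mwi\<close>, \<dots> stand for \<open>I(Y;W)\<close>, \<open>I(Y;WX\<^sub>i)\<close>, \<dots>. Rate is moved from \<open>i\<close> to \<open>j\<close> until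
  \<open>i\<close> has none left or a constraint on \<open>j\<close> becomes tight; in either case \<open>Ri' \<le> I(Y;X\<^sub>i|W)\<close>.\<close>

lemma transfer_rate:
  fixes Ri Rj T :: real
  assumes "0 \<le> Ri" "0 \<le> Rj"
    and "Ri \<le> Mwij - Mwj" "Rj \<le> Mwij - Mwi" "Ri + Rj \<le> Mwij - Mw"
      "Ri + T \<le> Mwij - Mj" "Rj + T \<le> Mwij - Mi" "Ri + Rj + T \<le> Mwij"
    and "Mw \<le> Mwi" "Mi \<le> Mwi - Mw"
  obtains Ri' Rj' where "0 \<le> Ri'" "0 \<le> Rj'" "Ri' + Rj' = Ri + Rj" "Ri' \<le> Mwi - Mw"
    "Ri' \<le> Mwij - Mwj" "Rj' \<le> Mwij - Mwi" "Ri' + T \<le> Mwij - Mj" "Rj' + T \<le> Mwij - Mi"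
proof -
  \<comment> \<open>The least admissible value: the last two entries are where the bounds on
    \<open>Rj'\<close> and on \<open>Rj' + T\<close> become tight. The entries are at most
    \<open>Mwi - Mw\<close> by \<open>Mw \<le> Mwi\<close>, by the bound on \<open>Ri + Rj\<close>,
    and by the bound on \<open>Ri + Rj + T\<close> with \<open>Mi \<le> Mwi - Mw\<close>,
    respectively.\<close>
  define Ri' where "Ri' = max 0 (max (Ri + Rj - (Mwij - Mwi)) (Ri + Rj + T - (Mwij - Mi)))"
  show thesis
    by (rule that[of Ri' "Ri + Rj - Ri'"]) (use assms in \<open>auto simp: Ri'_def max_def\<close>)
qed

lemma region_o_subset_region_r:
  assumes Z: "gaussian_tuple gp gsp gs gss N0 P Ps lam Z" and lam: "lam \<in> {0..1}"
    and pos: "0 < gp 1" "0 < gp 2" "0 < gsp" "0 < gs 1" "0 < gs 2" "0 < gss"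
      "0 < P 1" "0 < P 2" "0 < Ps" "0 < N0"
    and ij: "i \<in> {1, 2}" "j \<in> {1, 2}" "j \<noteq> i"
    and le: "CMI (pspace Z) (rvYp Z) (rvX Z i) (rvW Z)
      \<le> CMI (pspace Z) (rvYs Z) (rvX Z i) (rvU Z \<triangle> rvW Z)"
  shows "region_o Z \<subseteq> region_r i Z"
proof
  define Ip where "Ip = gaussian_info (gp i * P i + gp j * P j + gsp * lam * Ps + gsp * (1 - lam) * Ps + N0)"
  define Is where "Is = gaussian_info (gs i * P i + gs j * P j + gss * lam * Ps + gss * (1 - lam) * Ps + N0)"
  define wp us ws where "wp = gsp * (1 - lam) * Ps" and "us = gss * lam * Ps" and "ws = gss * (1 - lam) * Ps"
  note rates = gaussian_tuple_MI[OF Z pos(1-6,10) ij,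
      folded Ip_def Is_def wp_def us_def ws_def]
  have nn: "0 \<le> gp i * P i" "0 < gp j * P j" "0 \<le> wp" "0 \<le> gs i * P i" "0 < gs j * P j"
      "0 \<le> us" "0 \<le> ws" "0 \<le> gsp * lam * Ps"
    using pos ij lam by (auto simp: wp_def us_def ws_def)
  have Ip_mono: "Ip wp \<le> Ip (wp + gp i * P i)"
    unfolding Ip_def using nn pos by (intro gaussian_info_mono) (auto simp: wp_def)
  \<comment> \<open>Supermodularity at 0: conditioning on the independent \<open>W\<close> does not
    decrease the information that the primary output carries about the input
    \<open>i\<close>.\<close>
  have Ip_super: "Ip (gp i * P i) + Ip wp \<le> Ip (wp + gp i * P i)"
    using gaussian_info_supermodular[of "gp i * P i" wp 0] gaussian_info_0 nn pos
    by (simp add: Ip_def wp_def add_ac)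
  \<comment> \<open>The upper bound on \<open>s + a + b\<close> keeps it below the total variance,
    since input \<open>j\<close> and the noise remain.\<close>
  have Is_super: "Is (s + a) + Is (s + b) \<le> Is (s + a + b) + Is s"
    if "0 \<le> a" "0 \<le> b" "0 \<le> s" "s + a + b \<le> us + ws + gs i * P i" for s a b
    unfolding Is_def using that nn pos
    by (intro gaussian_info_supermodular) (auto simp: us_def ws_def)
  have Is_0: "Is 0 = 0"
    unfolding Is_def using nn pos by (intro gaussian_info_0) (simp add: us_def ws_def)
  fix x assume "x \<in> region_o Z"
  then obtain R S T where x: "x = (S + T, R 1 + R 2)" and R: "0 \<le> R 1" "0 \<le> R 2" "0 \<le> S" "0 \<le> T"
    and prim: "primary_rates Z R T" and sec: "secondary_rates_o Z S T"
    by (auto simp: region_o_def)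
  note prim' = prim[unfolded rates(1)] and sec' = sec[unfolded rates(2)]
  have "0 \<le> R i" "0 \<le> R j" using R ij by auto
  then obtain Ri Rj where R': "0 \<le> Ri" "0 \<le> Rj" "Ri + Rj = R i + R j" "Ri \<le> Ip (wp + gp i * P i) - Ip wp"
    "Ri \<le> Ip (wp + gp i * P i + gp j * P j) - Ip (wp + gp j * P j)"
    "Rj \<le> Ip (wp + gp i * P i + gp j * P j) - Ip (wp + gp i * P i)"
    "Ri + T \<le> Ip (wp + gp i * P i + gp j * P j) - Ip (gp j * P j)"
    "Rj + T \<le> Ip (wp + gp i * P i + gp j * P j) - Ip (gp i * P i)"
    using prim' Ip_mono Ip_super
    by (elim conjE) (rule transfer_rate[of "R i" "R j" "Ip (wp + gp i * P i + gp j * P j)"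
        "Ip (wp + gp j * P j)" "Ip (wp + gp i * P i)" "Ip wp" T
        "Ip (gp j * P j)" "Ip (gp i * P i)"], simp_all)
  define R'' where "R'' = R(i := Ri, j := Rj)"
  have R'': "R'' i = Ri" "R'' j = Rj" using ij by (auto simp: R''_def)
  \<comment> \<open>The total primary rate is unchanged, so the two constraints on it persist; the
    others come from the transfer.\<close>
  have "primary_rates Z R'' T"
    unfolding rates(1) R'' using R' prim' by simp
  moreover have "secondary_rates_r i Z Ri S T"
  proof -
    \<comment> \<open>The hypothesis \<open>le\<close> enters here, carrying the bound on
      \<open>Ri\<close> from the primary to the secondary output.\<close>
    have "Ri \<le> Is (us + ws + gs i * P i) - Is (us + ws)"
      using R'(4) le unfolding rates by linarith
    \<comment> \<open>This and the next two facts say that conditioning on input \<open>i\<close>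
      does not decrease the information about \<open>U\<close>, \<open>W\<close> and the pair, so
      the bounds on \<open>S\<close>, \<open>T\<close> and \<open>S + T\<close> survive. Adding the
      bound on \<open>Ri\<close> to the original ones gives the constraints that contain
      \<open>Ri\<close>.\<close>
    moreover have "Is (us + ws) + Is (ws + gs i * P i) \<le> Is (us + ws + gs i * P i) + Is ws"
      using Is_super[of us "gs i * P i" ws] nn by (simp add: add_ac)
    moreover have "Is (us + ws) + Is (us + gs i * P i) \<le> Is (us + ws + gs i * P i) + Is us"
      using Is_super[of ws "gs i * P i" us] nn by (simp add: add_ac)
    moreover have "Is (us + ws) + Is (gs i * P i) \<le> Is (us + ws + gs i * P i)"
      using Is_super[of "us + ws" "gs i * P i" 0] nn Is_0 by simp
    ultimately show ?thesis
      unfolding rates(3) using sec' by (elim conjE) (intro conjI; linarith)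
  qed
  moreover have "0 \<le> R'' 1" "0 \<le> R'' 2" "R'' 1 + R'' 2 = R 1 + R 2"
    using ij R' R'' by auto
  ultimately show "x \<in> region_r i Z"
    unfolding region_r_def x mem_Collect_eq using R R''(1)
    by (intro exI[of _ R''] exI[of _ S] exI[of _ T]) simp
qed

section \<open>Equivalence of the three conditions and inclusion of the closed regions\<close>

theorem mainTheorem6:
  fixes gp gs P :: "nat \<Rightarrow> real" and gsp gss Ps N0 :: real and i j :: nat
  assumes "gp 1 > 0" "gp 2 > 0" "gsp > 0" "gs 1 > 0" "gs 2 > 0" "gss > 0"
    and "P 1 > 0" "P 2 > 0" "Ps > 0" "N0 > 0"
    and "i \<in> {1, 2}" "j \<in> {1, 2}" "j \<noteq> i"
  shows "((\<forall>Z\<in>gaussian_family gp gsp gs gss N0 P Ps.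
            CMI (pspace Z) (rvYp Z) (rvX Z i) (rvW Z)
              \<le> CMI (pspace Z) (rvYs Z) (rvX Z i) (rvU Z \<triangle> rvW Z))
          \<longleftrightarrow> (\<forall>lam\<in>{0..1}.
            1/2 * log 2 (1 + gp i * P i / (gsp * lam * Ps + gp j * P j + N0))
              \<le> 1/2 * log 2 (1 + gs i * P i / (gs j * P j + N0))))
       \<and> ((\<forall>Z\<in>gaussian_family gp gsp gs gss N0 P Ps.
            CMI (pspace Z) (rvYp Z) (rvX Z i) (rvW Z)
              \<le> CMI (pspace Z) (rvYs Z) (rvX Z i) (rvU Z \<triangle> rvW Z))
          \<longleftrightarrow> gp i / (gp j * P j + N0) \<le> gs i / (gs j * P j + N0))
       \<and> (gp i / (gp j * P j + N0) \<le> gs i / (gs j * P j + N0)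
          \<longrightarrow> gaussian_region_o gp gsp gs gss N0 P Ps \<subseteq> gaussian_region_r i gp gsp gs gss N0 P Ps)"
    (is "(?all \<longleftrightarrow> ?formula) \<and> (_ \<longleftrightarrow> ?ratio) \<and> (_ \<longrightarrow> ?subset)")
proof -
  note pos = assms(1-10) and ij = assms(11-13)
  have nn: "0 < gp i" "0 < gp j" "0 < gs i" "0 < gs j" "0 < P i" "0 < P j"
    using pos ij by auto
  \<comment> \<open>At the primary output, \<open>U\<close>, input \<open>j\<close> and the noise
    remain as interference. At the secondary output \<open>U\<close> and \<open>W\<close> are both
    known, so \<open>lam\<close> drops out.\<close>
  have CMI_p: "CMI (pspace Z) (rvYp Z) (rvX Z i) (rvW Z)
      = 1/2 * log 2 (1 + gp i * P i / (gsp * lam * Ps + gp j * P j + N0))"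
    and CMI_s: "CMI (pspace Z) (rvYs Z) (rvX Z i) (rvU Z \<triangle> rvW Z)
      = 1/2 * log 2 (1 + gs i * P i / (gs j * P j + N0))"
    if "gaussian_tuple gp gsp gs gss N0 P Ps lam Z" "lam \<in> {0..1}" for lam and Z :: "(nat \<Rightarrow> real) tuple"
  proof -
    have "0 \<le> gsp * lam * Ps" "0 \<le> gsp * (1 - lam) * Ps" "0 \<le> gss * lam * Ps" "0 \<le> gss * (1 - lam) * Ps"
      "0 < gp i * P i" "0 < gp j * P j" "0 < gs i * P i" "0 < gs j * P j"
      using that(2) pos nn by auto
    then show "CMI (pspace Z) (rvYp Z) (rvX Z i) (rvW Z)
        = 1/2 * log 2 (1 + gp i * P i / (gsp * lam * Ps + gp j * P j + N0))"
      and "CMI (pspace Z) (rvYs Z) (rvX Z i) (rvU Z \<triangle> rvW Z)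
        = 1/2 * log 2 (1 + gs i * P i / (gs j * P j + N0))"
      using pos(10) by (subst gaussian_tuple_MI(4,5)[OF that(1) pos(1-6,10) ij]; subst gaussian_info_add; simp add: add_ac)+
  qed
  have all_formula: "?formula \<Longrightarrow> ?all"
  proof
    fix Z :: "(nat \<Rightarrow> real) tuple" assume formula: ?formula and "Z \<in> gaussian_family gp gsp gs gss N0 P Ps"
    then obtain lam where lam: "lam \<in> {0..1}" "gaussian_tuple gp gsp gs gss N0 P Ps lam Z"
      by (auto simp: gaussian_family_def)
    show "CMI (pspace Z) (rvYp Z) (rvX Z i) (rvW Z)
        \<le> CMI (pspace Z) (rvYs Z) (rvX Z i) (rvU Z \<triangle> rvW Z)"
      unfolding CMI_p[OF lam(2,1)] CMI_s[OF lam(2,1)] using formula lam(1) by blast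
  qed
  have formula_all: "?all \<Longrightarrow> ?formula"
  proof
    fix lam :: real assume all: ?all and lam: "lam \<in> {0..1}"
    obtain Z :: "(nat \<Rightarrow> real) tuple" where Z: "gaussian_tuple gp gsp gs gss N0 P Ps lam Z"
      using exists_gaussian_tuple[OF lam pos(7-10)] by blast
    then have "Z \<in> gaussian_family gp gsp gs gss N0 P Ps"
      using lam by (auto simp: gaussian_family_def)
    with all CMI_p[OF Z lam] CMI_s[OF Z lam]
    show "1/2 * log 2 (1 + gp i * P i / (gsp * lam * Ps + gp j * P j + N0))
        \<le> 1/2 * log 2 (1 + gs i * P i / (gs j * P j + N0))"
      by fastforce
  qed
  have ratio: "1/2 * log 2 (1 + gp i * P i / (gp j * P j + N0))
      \<le> 1/2 * log 2 (1 + gs i * P i / (gs j * P j + N0)) \<longleftrightarrow> ?ratio"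
    using nn pos(10) by (intro log_SINR_le_iff) (auto intro!: add_pos_pos)
  \<comment> \<open>The left side of the formula is largest at \<open>lam = 0\<close>, where
    \<open>U\<close> causes no interference; that single instance is the ratio condition.\<close>
  have formula_ratio: "?formula \<longleftrightarrow> ?ratio"
    unfolding ratio[symmetric]
  proof
    assume ?formula
    from bspec[OF this, of 0]
    show "1/2 * log 2 (1 + gp i * P i / (gp j * P j + N0))
      \<le> 1/2 * log 2 (1 + gs i * P i / (gs j * P j + N0))" by simp
  next
    assume le: "1/2 * log 2 (1 + gp i * P i / (gp j * P j + N0))
      \<le> 1/2 * log 2 (1 + gs i * P i / (gs j * P j + N0))"
    show ?formula
    proof
      fix lam :: real assume "lam \<in> {0..1}"
      then have "1/2 * log 2 (1 + gp i * P i / (gsp * lam * Ps + gp j * P j + N0))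
          \<le> 1/2 * log 2 (1 + gp i * P i / (gp j * P j + N0))"
        using nn pos by (intro log_SINR_mono) (auto intro!: add_pos_pos)
      with le show "1/2 * log 2 (1 + gp i * P i / (gsp * lam * Ps + gp j * P j + N0))
          \<le> 1/2 * log 2 (1 + gs i * P i / (gs j * P j + N0))" by linarith
    qed
  qed
  \<comment> \<open>The inclusion holds for each tuple separately, hence for the unions and their
    closures.\<close>
  have subset: "?all \<Longrightarrow> ?subset"
    unfolding gaussian_region_o_def gaussian_region_r_def
  proof (intro closure_mono UN_mono order_refl)
    fix Z :: "(nat \<Rightarrow> real) tuple" assume all: ?all and Z: "Z \<in> gaussian_family gp gsp gs gss N0 P Ps"
    then obtain lam where "lam \<in> {0..1}" "gaussian_tuple gp gsp gs gss N0 P Ps lam Z"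
      by (auto simp: gaussian_family_def)
    then show "region_o Z \<subseteq> region_r i Z"
      using region_o_subset_region_r[OF _ _ pos ij] bspec[OF all Z] by blast
  qed
  from all_formula formula_all formula_ratio subset show ?thesis by blast
qed

end
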